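(* Let $X$ be a nonempty weakly compact subset of a Banach space that has the Opial property. If a mapping $T:X\to X$ has a subinvariant metric functional, i.e. if there is $\mathbf{h}\in X^{\diamondsuit}$ with $\mathbf{h}(Tx)\le\mathbf{h}(x)$ for all $x\in X$, then $T$ has a fixed point in $X$.
   Context: A Banach space $E$ (with norm $\|\cdot\|$, real scalars) has the Opial property if whenever a sequence $(a_n)$ in $E$ converges weakly to $a$, one has $\liminf_n\|a_n-a\|<\liminf_n\|a_n-x\|$ for all $x\in E$ with $x\ne a$. Metric functionals: let $X$ carry the metric $d(x,y)=\|x-y\|$ and fix a base point $o\in X$. For $w\in X$ define $\mathbf{h}_w:X\to\mathbb{R}$ by $\mathbf{h}_w(x)=d(x,w)-d(o,w)$. $X^{\diamondsuit}$ is the closure of $\{\mathbf{h}_w : w\in X\}$ in $\mathbb{R}^X$ (all functions $X\to\mathbb{R}$) with the topology of pointwise convergence; its elements are the metric functionals on $X$. *)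

theory Defs
  imports "HOL-Analysis.Analysis"
begin

text \<open>The pullback along \<open>x \<mapsto> (f \<mapsto> f x)\<close> of the product topology on real-valued functions on the
  continuous dual, i.e. the coarsest topology making all continuous linear functionals
  continuous.\<close>

definition weak_topology :: "'a::real_normed_vector topology" where
  "weak_topology =
     pullback_topology UNIV (\<lambda>x f. blinfun_apply f x) (euclidean :: (('a \<Rightarrow>\<^sub>L real) \<Rightarrow> real) topology)"

lemma topspace_weak_topology [simp]: "topspace weak_topology = UNIV"
  by (simp add: weak_topology_def topspace_pullback_topology)

lemma continuous_map_weak_topology:
  "continuous_map weak_topology euclideanreal (blinfun_apply f)"
proof -
  have "continuous_on UNIV (\<lambda>g :: ('a \<Rightarrow>\<^sub>L real) \<Rightarrow> real. g f)"
    by (rule continuous_on_product_coordinates)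
  then have "continuous_map euclidean euclideanreal (\<lambda>g :: ('a \<Rightarrow>\<^sub>L real) \<Rightarrow> real. g f)"
    by simp
  from continuous_map_pullback[OF this, of UNIV "\<lambda>x f. blinfun_apply f x"]
  show ?thesis
    by (simp add: weak_topology_def o_def)
qed

lemma limitin_weak_topology:
  fixes l :: "'a::real_normed_vector"
  shows "limitin weak_topology a l F \<longleftrightarrow> (\<forall>f :: 'a \<Rightarrow>\<^sub>L real. ((\<lambda>n. blinfun_apply f (a n)) \<longlongrightarrow> blinfun_apply f l) F)"
proof
  assume "limitin weak_topology a l F"
  from continuous_map_limit[OF continuous_map_weak_topology this]
  show "\<forall>f :: 'a \<Rightarrow>\<^sub>L real. ((\<lambda>n. blinfun_apply f (a n)) \<longlongrightarrow> blinfun_apply f l) F"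
    by (simp add: o_def)
next
  assume R: "\<forall>f :: 'a \<Rightarrow>\<^sub>L real. ((\<lambda>n. blinfun_apply f (a n)) \<longlongrightarrow> blinfun_apply f l) F"
  have "limitin (product_topology (\<lambda>_. euclideanreal) UNIV)
          (\<lambda>n (f :: 'a \<Rightarrow>\<^sub>L real). blinfun_apply f (a n)) (\<lambda>f. blinfun_apply f l) F"
    using R by (auto simp: limitin_componentwise)
  then have lim: "limitin euclidean (\<lambda>n (f :: 'a \<Rightarrow>\<^sub>L real). blinfun_apply f (a n)) (\<lambda>f. blinfun_apply f l) F"
    by (simp add: euclidean_product_topology)
  show "limitin weak_topology a l F"
    unfolding limitin_def
  proof (intro conjI allI impI)
    fix U assume "openin weak_topology U \<and> l \<in> U"
    then obtain V where V: "open V" "U = (\<lambda>x (f :: 'a \<Rightarrow>\<^sub>L real). blinfun_apply f x) -` V" "l \<in> U"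
      by (auto simp: weak_topology_def openin_pullback_topology)
    then have "\<forall>\<^sub>F n in F. (\<lambda>f :: 'a \<Rightarrow>\<^sub>L real. blinfun_apply f (a n)) \<in> V"
      using lim unfolding limitin_def by (metis open_openin vimage_eq)
    then show "\<forall>\<^sub>F n in F. a n \<in> U"
      by (simp add: V(2))
  qed simp
qed

text \<open>The lower limits are taken in the extended reals because \<^const>\<open>liminf\<close> needs a
  complete lattice. They are finite here: weakly convergent sequences are bounded.\<close>

definition opial_property :: "'a::real_normed_vector itself \<Rightarrow> bool" where
  "opial_property _ \<longleftrightarrow>
     (\<forall>(a :: nat \<Rightarrow> 'a) l. limitin weak_topology a l sequentially \<longrightarrow>
        (\<forall>x. x \<noteq> l \<longrightarrow>
           liminf (\<lambda>n. ereal (norm (a n - l))) < liminf (\<lambda>n. ereal (norm (a n - x)))))"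

text \<open>Real-valued functions on a set \<open>X\<close> are represented extensionally, as elements of
  \<open>X \<rightarrow>\<^sub>E UNIV\<close>; the product topology over \<open>X\<close> is then the topology of pointwise convergence.\<close>

definition internal_functional :: "'a::metric_space set \<Rightarrow> 'a \<Rightarrow> 'a \<Rightarrow> 'a \<Rightarrow> real" where
  "internal_functional X p w = (\<lambda>x\<in>X. dist x w - dist p w)"

definition metric_functionals :: "'a::metric_space set \<Rightarrow> 'a \<Rightarrow> ('a \<Rightarrow> real) set" where
  "metric_functionals X p =
     product_topology (\<lambda>_. euclideanreal) X closure_of (internal_functional X p ` X)"

end

theory Submission
  imports Defs
begin

text \<open>The reason is that, in a space with the Opial property, a metric functional \<open>h\<close> on a weakly
  compact set has a strict global minimum \<open>z\<close>; since \<open>h (T z) \<le> h z\<close>, this point is fixed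
  (\<open>metric_functional_strict_minimum\<close>).

  To find \<open>z\<close>, write \<open>h\<close> as a pointwise limit of internal functionals \<open>h\<^sub>w\<close> along a filter of
  points \<open>w\<close> and let \<open>z\<close> be a weak cluster point of that filter. If this filter could be replaced
  by a sequence \<open>a\<close>, the Opial property would finish the proof: for \<open>y \<noteq> z\<close> the base point
  cancels in \<open>h z - h y = lim (norm (a n - z) - norm (a n - y))\<close>, and the limit is negative
  because the lower limit of \<open>norm (a n - z)\<close> is the smaller one.

  A sequence that serves all \<open>y\<close> at once need not exist. But for the comparison with one \<open>y\<close> only
  the two values \<open>h z\<close> and \<open>h y\<close> have to be approximated, and countably many such
  conditions can be met: a weak cluster point of a filter on a weakly compact set is the weak limit
  of a sequence that satisfies any prescribed countable list of conditions holding eventually along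
  the filter (\<open>sequence_of_weak_cluster_point\<close>). This is the part of the Eberlein--Smulian theory
  which says that weakly compact sets are angelic. Its proof needs functionals that norm a given
  vector and functionals that separate a point from a closed subspace; both come from one form of
  the Hahn--Banach theorem (\<open>functional_attaining_infdist\<close>).\<close>

section \<open>Hahn--Banach through minimal sublinear functionals\<close>

text \<open>Homogeneity is required for positive scalars only; the value at zero then follows.\<close>

definition sublinear :: "('a::real_vector \<Rightarrow> real) \<Rightarrow> bool" where
  "sublinear q \<longleftrightarrow> (\<forall>x y. q (x + y) \<le> q x + q y) \<and> (\<forall>c x. c > 0 \<longrightarrow> q (c *\<^sub>R x) = c * q x)"

text \<open>One inequality in the homogeneity law is enough, since applying it to the inverse scalar gives
  the other one. The infima formed below are only bounded above in the obvious way, so this saves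
  half of each verification.\<close>

lemma sublinearI:
  assumes "\<And>x y. q (x + y) \<le> q x + q y"
    and le: "\<And>c x. c > 0 \<Longrightarrow> q (c *\<^sub>R x) \<le> c * q x"
  shows "sublinear q"
proof -
  have "q (c *\<^sub>R x) = c * q x" if "c > 0" for c x
  proof (rule antisym)
    have "q (inverse c *\<^sub>R (c *\<^sub>R x)) \<le> inverse c * q (c *\<^sub>R x)"
      by (rule le) (use that in simp)
    then show "c * q x \<le> q (c *\<^sub>R x)"
      using that by (simp add: field_simps)
  qed (rule le[OF that])
  then show ?thesis
    using assms by (auto simp: sublinear_def)
qed

lemma sublinear_add: "sublinear q \<Longrightarrow> q (x + y) \<le> q x + q y"
  by (simp add: sublinear_def)

lemma sublinear_scale_pos: "sublinear q \<Longrightarrow> c > 0 \<Longrightarrow> q (c *\<^sub>R x) = c * q x"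
  by (simp add: sublinear_def)

lemma sublinear_0: "sublinear q \<Longrightarrow> q 0 = 0"
  using sublinear_scale_pos[of q 2 0] by simp

lemma sublinear_scale: "sublinear q \<Longrightarrow> c \<ge> 0 \<Longrightarrow> q (c *\<^sub>R x) = c * q x"
  by (cases "c = 0") (auto simp: sublinear_0 sublinear_scale_pos)

lemma sublinear_ge_minus: "sublinear q \<Longrightarrow> - q (- x) \<le> q x"
  using sublinear_add[of q x "- x"] sublinear_0[of q] by simp

text \<open>A sublinear function lies above some sublinear function that is as small as possible at
  \<open>- u\<close>: subtract \<open>t * q u\<close> after moving by \<open>t *\<^sub>R u\<close> and take the infimum over \<open>t \<ge> 0\<close>. This
  construction is used twice, to show that minimal sublinear functions are odd and to prescribe the
  value of a linear minorant at one point.\<close>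

lemma sublinear_minorant_at:
  assumes q: "sublinear q"
  shows "\<exists>r. sublinear r \<and> (\<forall>x. r x \<le> q x) \<and> r (- u) \<le> - q u"
proof -
  define g where "g x t = q (x + t *\<^sub>R u) - t * q u" for x t
  define r where "r x = (INF t\<in>{0..}. g x t)" for x
  have g_ge: "- q (- x) \<le> g x t" if "t \<ge> 0" for x t
    using sublinear_add[OF q, of "x + t *\<^sub>R u" "- x"] sublinear_scale[OF q that, of u]
    by (simp add: g_def)
  have bdd: "bdd_below (g x ` {0..})" for x
    using g_ge by (intro bdd_belowI2[where m = "- q (- x)"]) auto
  have r_le: "r x \<le> g x t" if "t \<ge> 0" for x t
    unfolding r_def by (rule cINF_lower[OF bdd]) (use that in simp)
  have r_ge: "m \<le> r x" if "\<And>t. t \<ge> 0 \<Longrightarrow> m \<le> g x t" for m x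
    unfolding r_def by (rule cINF_greatest) (use that in auto)
  have "sublinear r"
  proof (rule sublinearI)
    fix x y
    have *: "r (x + y) \<le> g x s + g y t" if "s \<ge> 0" "t \<ge> 0" for s t
    proof -
      have "r (x + y) \<le> g (x + y) (s + t)"
        by (rule r_le) (use that in simp)
      also have "\<dots> \<le> g x s + g y t"
        using sublinear_add[OF q, of "x + s *\<^sub>R u" "y + t *\<^sub>R u"]
        by (simp add: g_def algebra_simps)
      finally show ?thesis .
    qed
    have "r (x + y) - g x s \<le> r y" if "s \<ge> 0" for s
      by (rule r_ge) (use *[OF that] in \<open>simp add: algebra_simps\<close>)
    then have "r (x + y) - r y \<le> r x"
      by (intro r_ge) (simp add: algebra_simps)
    then show "r (x + y) \<le> r x + r y"
      by simp
  next
    fix c :: real and x assume c: "c > 0"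
    have "r (c *\<^sub>R x) / c \<le> g x t" if "t \<ge> 0" for t
    proof -
      have "r (c *\<^sub>R x) \<le> g (c *\<^sub>R x) (c * t)"
        by (rule r_le) (use that c in simp)
      also have "\<dots> = c * g x t"
        using sublinear_scale_pos[OF q c, of "x + t *\<^sub>R u"]
        by (simp add: g_def algebra_simps)
      finally show ?thesis
        using c by (simp add: field_simps)
    qed
    then have "r (c *\<^sub>R x) / c \<le> r x"
      by (rule r_ge)
    then show "r (c *\<^sub>R x) \<le> c * r x"
      using c by (simp add: field_simps)
  qed
  moreover have "r x \<le> q x" for x
    using r_le[of 0 x] by (simp add: g_def)
  moreover have "r (- u) \<le> - q u"
    using r_le[of 1 "- u"] by (simp add: g_def sublinear_0[OF q])
  ultimately show ?thesis
    by blast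
qed

text \<open>Zorn's lemma applies because a chain of sublinear functions below \<open>p\<close> is bounded below
  pointwise by \<open>\<lambda>x. - p (- x)\<close>, and its pointwise infimum is again sublinear.\<close>

lemma minimal_sublinear_below:
  assumes p: "sublinear p"
  shows "\<exists>m. sublinear m \<and> (\<forall>x. m x \<le> p x) \<and>
           (\<forall>q. sublinear q \<and> (\<forall>x. q x \<le> m x) \<longrightarrow> q = m)"
proof -
  define A where "A = {q. sublinear q \<and> (\<forall>x. q x \<le> p x)}"
  define P where "P q r \<longleftrightarrow> (\<forall>x. r x \<le> q x)" for q r :: "'a \<Rightarrow> real"
  have "\<exists>m\<in>A. \<forall>q\<in>A. P m q \<longrightarrow> q = m"
  proof (rule predicate_Zorn)
    show "partial_order_on A (relation_of P A)"
      by (rule partial_order_on_relation_ofI) (auto simp: P_def fun_eq_iff intro: order_trans antisym)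
  next
    fix C assume C: "C \<in> Chains (relation_of P A)"
    then have CA: "C \<subseteq> A"
      by (auto simp: Chains_def relation_of_def)
    have chain: "(\<forall>x. r x \<le> q x) \<or> (\<forall>x. q x \<le> r x)" if "q \<in> C" "r \<in> C" for q r
      using C that by (auto simp: Chains_def relation_of_def P_def)
    show "\<exists>u\<in>A. \<forall>a\<in>C. P a u"
    proof (cases "C = {}")
      case True
      then show ?thesis
        using p by (auto simp: A_def)
    next
      case False
      define r where "r x = (INF q\<in>C. q x)" for x
      have sub: "sublinear q" and le_p: "q x \<le> p x" if "q \<in> C" for q x
        using that CA by (auto simp: A_def)
      have bdd: "bdd_below ((\<lambda>q. q x) ` C)" for x
        using sublinear_ge_minus[OF sub, of _ x] le_p[of _ "- x"]
        by (intro bdd_belowI2[where m = "- p (- x)"]) (smt (verit))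
      have r_le: "r x \<le> q x" if "q \<in> C" for q x
        unfolding r_def by (rule cINF_lower[OF bdd that])
      have r_ge: "m \<le> r x" if "\<And>q. q \<in> C \<Longrightarrow> m \<le> q x" for m x
        unfolding r_def by (rule cINF_greatest[OF False]) (use that in auto)
      have "sublinear r"
      proof (rule sublinearI)
        fix x y
        \<comment> \<open>Two members of the chain are comparable, so the smaller one bounds both summands.\<close>
        have *: "r (x + y) \<le> q x + q' y" if "q \<in> C" "q' \<in> C" for q q'
          using chain[OF that] r_le[OF that(1), of "x + y"] r_le[OF that(2), of "x + y"]
            sublinear_add[OF sub[OF that(1)], of x y] sublinear_add[OF sub[OF that(2)], of x y]
          by (smt (verit))
        have "r (x + y) - q x \<le> r y" if "q \<in> C" for q
          by (rule r_ge) (use *[OF that] in \<open>simp add: algebra_simps\<close>)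
        then have "r (x + y) - r y \<le> r x"
          by (intro r_ge) (simp add: algebra_simps)
        then show "r (x + y) \<le> r x + r y"
          by simp
      next
        fix c :: real and x assume c: "c > 0"
        have "r (c *\<^sub>R x) / c \<le> r x"
          using c r_le[of _ "c *\<^sub>R x"] sublinear_scale_pos[OF sub c]
          by (intro r_ge) (simp add: field_simps)
        then show "r (c *\<^sub>R x) \<le> c * r x"
          using c by (simp add: field_simps)
      qed
      moreover obtain q where "q \<in> C"
        using False by blast
      ultimately have "r \<in> A"
        using r_le[OF \<open>q \<in> C\<close>] le_p[OF \<open>q \<in> C\<close>] by (auto simp: A_def intro: order_trans)
      then show ?thesis
        using r_le by (auto simp: P_def)
    qed
  qed
  then obtain m where m: "m \<in> A" "\<And>q. q \<in> A \<Longrightarrow> P m q \<Longrightarrow> q = m"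
    by blast
  have "q = m" if "sublinear q" "\<And>x. q x \<le> m x" for q
    using m that by (intro m(2)) (auto simp: A_def P_def intro: order_trans)
  then show ?thesis
    using m(1) by (auto simp: A_def)
qed

text \<open>By minimality the minorant of \<open>sublinear_minorant_at\<close> is \<open>m\<close> itself, for every \<open>u\<close>. Hence
  \<open>m\<close> is odd, and an odd subadditive function is additive.\<close>

lemma linear_if_minimal_sublinear:
  assumes m: "sublinear m" and min: "\<And>q. sublinear q \<Longrightarrow> (\<And>x. q x \<le> m x) \<Longrightarrow> q = m"
  shows "linear m"
proof -
  have "m (- u) \<le> - m u" for u
    using sublinear_minorant_at[OF m, of u] min by blast
  then have neg: "m (- u) = - m u" for u
    using sublinear_ge_minus[OF m, of "- u"] by (smt (verit) minus_minus)
  have add: "m (x + y) = m x + m y" for x y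
    using sublinear_add[OF m, of x y] sublinear_add[OF m, of "x + y" "- y"] neg[of y] by simp
  have scale: "m (c *\<^sub>R x) = c * m x" for c x
  proof (cases "c \<ge> 0")
    case False
    then show ?thesis
      using sublinear_scale[OF m, of "- c" x] neg[of "c *\<^sub>R x"] by simp
  qed (rule sublinear_scale[OF m])
  show ?thesis
    by (rule linearI) (simp_all add: add scale)
qed

text \<open>First push the function down at \<open>- u\<close>, then take a minimal sublinear function below the
  result. It is linear, so its upper bound \<open>- p u\<close> at \<open>- u\<close> is a lower bound \<open>p u\<close> at \<open>u\<close>.\<close>

theorem Hahn_Banach_sublinear:
  assumes p: "sublinear p"
  obtains f where "linear f" "\<And>x. f x \<le> p x" "f u = p u"
proof -
  obtain q where q: "sublinear q" "\<And>x. q x \<le> p x" "q (- u) \<le> - p u"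
    using sublinear_minorant_at[OF p] by blast
  obtain f where f: "sublinear f" "\<And>x. f x \<le> q x"
      "\<And>r. sublinear r \<Longrightarrow> (\<And>x. r x \<le> f x) \<Longrightarrow> r = f"
    using minimal_sublinear_below[OF q(1)] by blast
  have lin: "linear f"
    using f(1,3) by (rule linear_if_minimal_sublinear)
  have le: "f x \<le> p x" for x
    using f(2) q(2) by (rule order_trans)
  have "- f u \<le> - p u"
    using f(2)[of "- u"] q(3) linear_neg[OF lin, of u] by simp
  then have "f u = p u"
    using le[of u] by simp
  with lin le show ?thesis
    by (rule that)
qed

lemma sublinear_infdist:
  fixes Y :: "'a::real_normed_vector set"
  assumes Y: "subspace Y"
  shows "sublinear (\<lambda>x. infdist x Y)"
proof (rule sublinearI)
  have ne: "Y \<noteq> {}"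
    using Y subspace_0 by blast
  have ge: "m \<le> infdist x Y" if "\<And>a. a \<in> Y \<Longrightarrow> m \<le> dist x a" for m x
    using that by (auto simp: infdist_notempty[OF ne] intro: cINF_greatest[OF ne])
  {
    fix x y
    have *: "infdist (x + y) Y \<le> dist x a + dist y b" if "a \<in> Y" "b \<in> Y" for a b
    proof -
      have "infdist (x + y) Y \<le> dist (x + y) (a + b)"
        by (intro infdist_le subspace_add[OF Y] that)
      also have "\<dots> \<le> dist x a + dist y b"
        by (rule dist_triangle_add)
      finally show ?thesis .
    qed
    have "infdist (x + y) Y - dist x a \<le> infdist y Y" if "a \<in> Y" for a
      by (rule ge) (use *[OF that] in \<open>simp add: algebra_simps\<close>)
    then have "infdist (x + y) Y - infdist y Y \<le> infdist x Y"
      by (intro ge) (simp add: algebra_simps)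
    then show "infdist (x + y) Y \<le> infdist x Y + infdist y Y"
      by simp
  next
    fix c :: real and x :: 'a assume c: "c > 0"
    have "infdist (c *\<^sub>R x) Y / c \<le> dist x a" if "a \<in> Y" for a
    proof -
      have "infdist (c *\<^sub>R x) Y \<le> dist (c *\<^sub>R x) (c *\<^sub>R a)"
        by (intro infdist_le subspace_scale[OF Y] that)
      also have "\<dots> = c * dist x a"
        using c by (simp add: dist_norm flip: scaleR_diff_right)
      finally show ?thesis
        using c by (simp add: field_simps)
    qed
    then have "infdist (c *\<^sub>R x) Y / c \<le> infdist x Y"
      by (rule ge)
    then show "infdist (c *\<^sub>R x) Y \<le> c * infdist x Y"
      using c by (simp add: field_simps)
  }
qed

text \<open>The case of the Hahn--Banach theorem in which the sublinear function is the distance to a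
  subspace. Such a functional vanishes on \<open>Y\<close>, so it separates \<open>u\<close> from \<open>Y\<close> whenever \<open>u\<close> is
  not in the closure; for \<open>Y = {0}\<close> it is a norming functional.\<close>

lemma functional_attaining_infdist:
  fixes Y :: "'a::real_normed_vector set"
  assumes Y: "subspace Y"
  obtains f :: "'a \<Rightarrow>\<^sub>L real"
    where "blinfun_apply f u = infdist u Y" "\<And>x. \<bar>blinfun_apply f x\<bar> \<le> infdist x Y"
proof -
  obtain g where g: "linear g" "\<And>x. g x \<le> infdist x Y" "g u = infdist u Y"
    using Hahn_Banach_sublinear[OF sublinear_infdist[OF Y], of u] by blast
  have ne: "Y \<noteq> {}"
    using subspace_0[OF Y] by blast
  have "infdist (- x) Y \<le> dist x a" if "a \<in> Y" for x a
    using infdist_le[OF subspace_neg[OF Y that], of "- x"] by (simp add: dist_minus)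
  then have "infdist (- x) Y \<le> infdist x Y" for x
    by (auto simp: infdist_notempty[OF ne, of x] intro: cINF_greatest[OF ne])
  then have abs: "\<bar>g x\<bar> \<le> infdist x Y" for x
    using g(2)[of x] g(2)[of "- x"] linear_neg[OF g(1), of x] by (smt (verit))
  have "infdist x Y \<le> norm x" for x
    using infdist_le[OF subspace_0[OF Y], of x] by simp
  then have "norm (g x) \<le> norm x * 1" for x
    using abs[of x] by (simp add: order_trans[OF abs])
  then have "bounded_linear g"
    by (intro bounded_linear_intro[of g 1]) (auto simp: linear_add[OF g(1)] linear_scale[OF g(1)])
  then have "blinfun_apply (Blinfun g) = g"
    by (rule bounded_linear_Blinfun_apply)
  with that[of "Blinfun g"] g(3) abs show ?thesis
    by simp
qed

lemma norming_functional:
  fixes u :: "'a::real_normed_vector"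
  obtains f :: "'a \<Rightarrow>\<^sub>L real"
    where "blinfun_apply f u = norm u" "\<And>x. \<bar>blinfun_apply f x\<bar> \<le> norm x"
  using functional_attaining_infdist[OF subspace_single_0, of u] by (auto simp: subspace_0)


section \<open>Cluster points of filters in compact sets\<close>

text \<open>A point \<open>z\<close> is a cluster point of a filter \<open>G\<close> if every neighbourhood of \<open>z\<close> meets every set of
  \<open>G\<close>. This is expressed as \<open>inf (nhdsin T z) G \<noteq> bot\<close>: limits along \<open>nhdsin T z\<close> and along \<open>G\<close>
  then hold simultaneously along a proper filter.\<close>

lemma tendsto_nhdsin_weak_topology:
  fixes f :: "'a::real_normed_vector \<Rightarrow>\<^sub>L real"
  shows "((\<lambda>w. blinfun_apply f w) \<longlongrightarrow> blinfun_apply f z) (nhdsin weak_topology z)"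
proof -
  have "limitin weak_topology (\<lambda>w. w) z (nhdsin weak_topology z)"
    by (auto simp: limitin_def eventually_nhdsin)
  then show ?thesis
    by (simp add: limitin_weak_topology)
qed

text \<open>If no point of \<open>X\<close> were a cluster point, each would have an open neighbourhood that \<open>G\<close>
  eventually avoids; finitely many of them cover \<open>X\<close>, so \<open>G\<close> would eventually avoid \<open>X\<close>.\<close>

lemma compactin_cluster_point:
  assumes X: "compactin T X" and G: "G \<noteq> bot" "eventually (\<lambda>w. w \<in> X) G"
  obtains z where "z \<in> X" "inf (nhdsin T z) G \<noteq> bot"
proof (rule ccontr)
  assume "\<not> thesis"
  then have bot: "inf (nhdsin T z) G = bot" if "z \<in> X" for z
    using that \<open>\<And>z. z \<in> X \<Longrightarrow> inf (nhdsin T z) G \<noteq> bot \<Longrightarrow> thesis\<close> by blast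
  have XT: "X \<subseteq> topspace T"
    using X by (simp add: compactin_def)
  have "\<exists>U. openin T U \<and> z \<in> U \<and> eventually (\<lambda>w. w \<notin> U) G" if "z \<in> X" for z
  proof -
    have "eventually (\<lambda>_. False) (inf (nhdsin T z) G)"
      using bot[OF that] by simp
    then obtain Q R where QR: "eventually Q (nhdsin T z)" "eventually R G" "\<And>x. Q x \<Longrightarrow> R x \<Longrightarrow> False"
      by (auto simp: eventually_inf)
    have "z \<in> topspace T"
      using XT that by blast
    then obtain U where "openin T U" "z \<in> U" "\<And>x. x \<in> U \<Longrightarrow> Q x"
      using QR(1) by (auto simp: eventually_nhdsin)
    moreover from this have "eventually (\<lambda>w. w \<notin> U) G"
      using QR(3) by (intro eventually_mono[OF QR(2)]) blast
    ultimately show ?thesis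
      by blast
  qed
  then obtain U where U: "\<And>z. z \<in> X \<Longrightarrow> openin T (U z)" "\<And>z. z \<in> X \<Longrightarrow> z \<in> U z"
      "\<And>z. z \<in> X \<Longrightarrow> eventually (\<lambda>w. w \<notin> U z) G"
    by metis
  have "\<forall>V\<in>U ` X. openin T V" "X \<subseteq> \<Union>(U ` X)"
    using U(1,2) by auto
  with X have "\<exists>\<F>. finite \<F> \<and> \<F> \<subseteq> U ` X \<and> X \<subseteq> \<Union>\<F>"
    unfolding compactin_def by (metis (no_types))
  then obtain \<F> where \<F>: "finite \<F>" "\<F> \<subseteq> U ` X" "X \<subseteq> \<Union>\<F>"
    by blast
  have "eventually (\<lambda>w. \<forall>V\<in>\<F>. w \<notin> V) G"
    using \<F>(1,2) U(3) by (intro eventually_ball_finite) auto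
  with G(2) have "eventually (\<lambda>_. False) G"
    by eventually_elim (use \<F>(3) in blast)
  with G(1) show False
    by (simp add: trivial_limit_def)
qed

text \<open>If \<open>a\<close> left some open neighbourhood of \<open>z\<close> frequently, restricting the filter to these
  instants and using compactness would give a cluster point other than \<open>z\<close>.\<close>

lemma limitin_if_unique_cluster_point:
  assumes X: "compactin T X" and a: "eventually (\<lambda>n. a n \<in> X) F" and z: "z \<in> topspace T"
    and unique: "\<And>y. y \<in> X \<Longrightarrow> inf (nhdsin T y) (filtermap a F) \<noteq> bot \<Longrightarrow> y = z"
  shows "limitin T a z F"
proof (rule ccontr)
  assume "\<not> limitin T a z F"
  then obtain U where U: "openin T U" "z \<in> U" "\<not> eventually (\<lambda>n. a n \<in> U) F"
    using z by (auto simp: limitin_def)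
  define H where "H = inf (filtermap a F) (principal (- U))"
  have "H \<noteq> bot"
    using U(3) by (simp add: H_def trivial_limit_def eventually_inf_principal eventually_filtermap)
  moreover have "eventually (\<lambda>w. w \<in> X) H"
    using a by (simp add: H_def eventually_inf_principal eventually_filtermap eventually_mono)
  ultimately obtain y where y: "y \<in> X" "inf (nhdsin T y) H \<noteq> bot"
    using compactin_cluster_point[OF X] by blast
  have "inf (nhdsin T y) H \<le> inf (nhdsin T y) (filtermap a F)"
    by (auto simp: H_def intro: le_infI2)
  then have "y = z"
    using y by (intro unique) (metis bot_unique)+
  have "eventually (\<lambda>w. w \<in> U) (nhdsin T z)"
    using U z by (auto simp: eventually_nhdsin)
  moreover have "eventually (\<lambda>w. w \<notin> U) H"
    by (simp add: H_def eventually_inf_principal)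
  ultimately have "eventually (\<lambda>_. False) (inf (nhdsin T z) H)"
    unfolding eventually_inf by blast
  with y(2) \<open>y = z\<close> show False
    by (simp add: trivial_limit_def)
qed

lemma filtercomap_nhdsin_closure_of:
  assumes "h \<in> T closure_of (f ` S)"
  shows "inf (filtercomap f (nhdsin T h)) (principal S) \<noteq> bot"
proof
  assume "inf (filtercomap f (nhdsin T h)) (principal S) = bot"
  then have "eventually (\<lambda>w. w \<notin> S) (filtercomap f (nhdsin T h))"
    by (simp add: trivial_limit_def eventually_inf_principal)
  then obtain Q where "eventually Q (nhdsin T h)" "\<And>w. Q (f w) \<Longrightarrow> w \<notin> S"
    by (auto simp: eventually_filtercomap)
  then obtain U where U: "openin T U" "h \<in> U" "\<And>w. f w \<in> U \<Longrightarrow> w \<notin> S"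
    using assms by (auto simp: eventually_nhdsin in_closure_of)
  obtain y where "y \<in> f ` S" "y \<in> U"
    using assms U(1,2) unfolding in_closure_of by blast
  with U(3) show False
    by blast
qed

section \<open>From weak cluster points to weakly convergent sequences\<close>

text \<open>Lists of coefficient-index pairs form a countable type, and addition of combinations is
  concatenation of lists, without any bookkeeping of supports.\<close>

definition rational_combination :: "(nat \<Rightarrow> 'a::real_vector) \<Rightarrow> (rat \<times> nat) list \<Rightarrow> 'a" where
  "rational_combination a l = (\<Sum>(q, i)\<leftarrow>l. real_of_rat q *\<^sub>R a i)"

lemma rational_combination_cong:
  assumes "\<And>i. i \<in> snd ` set l \<Longrightarrow> a i = b i"
  shows "rational_combination a l = rational_combination b l"
  unfolding rational_combination_def
  by (intro arg_cong[of _ _ sum_list] map_cong) (use assms in force)+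

text \<open>Each closure property extends from \<open>S\<close> to its closure in one argument at a time, as preimages
  of closed sets under continuous maps are closed; real scalars are reached because the rationals
  are dense.\<close>

lemma subspace_closure_rational:
  fixes S :: "'a::real_normed_vector set"
  assumes "0 \<in> S" and add: "\<And>x y. x \<in> S \<Longrightarrow> y \<in> S \<Longrightarrow> x + y \<in> S"
    and scale: "\<And>q x. x \<in> S \<Longrightarrow> real_of_rat q *\<^sub>R x \<in> S"
  shows "subspace (closure S)"
  unfolding subspace_def
proof (intro conjI ballI allI)
  show "0 \<in> closure S"
    using \<open>0 \<in> S\<close> closure_subset by blast
next
  have *: "closure S \<subseteq> g -` closure S" if "continuous_on UNIV g" "S \<subseteq> g -` closure S" for g :: "'a \<Rightarrow> 'a"
    using that by (intro closure_minimal) (auto intro: closed_vimage)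
  have "closure S \<subseteq> (\<lambda>y. x + y) -` closure S" if "x \<in> S" for x
    using add[OF that] closure_subset[of S] by (intro *) (auto intro!: continuous_intros)
  then have "closure S \<subseteq> (\<lambda>x. x + y) -` closure S" if "y \<in> closure S" for y
    using that by (intro *) (auto intro!: continuous_intros)
  then show "x + y \<in> closure S" if "x \<in> closure S" "y \<in> closure S" for x y
    using that by blast
  have "closure \<rat> \<subseteq> (\<lambda>c. c *\<^sub>R x) -` closure S" if "x \<in> S" for x
    using scale[OF that] closure_subset
    by (intro closure_minimal closed_vimage) (auto elim!: Rats_cases intro!: continuous_intros)
  then have "closure S \<subseteq> (\<lambda>x. c *\<^sub>R x) -` closure S" for c
    by (intro *) (auto simp: Rats_closure_real intro!: continuous_intros)
  then show "c *\<^sub>R x \<in> closure S" if "x \<in> closure S" for c x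
    using that by blast
qed

lemma subspace_closure_rational_combinations:
  fixes a :: "nat \<Rightarrow> 'a::real_normed_vector"
  shows "subspace (closure (range (rational_combination a)))"
proof (rule subspace_closure_rational)
  show "0 \<in> range (rational_combination a)"
    by (rule range_eqI[of _ _ "[]"]) (simp add: rational_combination_def)
next
  fix x y assume "x \<in> range (rational_combination a)" "y \<in> range (rational_combination a)"
  then obtain k l where "x = rational_combination a k" "y = rational_combination a l"
    by blast
  then show "x + y \<in> range (rational_combination a)"
    by (intro range_eqI[of _ _ "k @ l"]) (simp add: rational_combination_def)
next
  fix q x assume "x \<in> range (rational_combination a)"
  then obtain l where l: "x = rational_combination a l"
    by blast
  have "real_of_rat q *\<^sub>R rational_combination a l =
      rational_combination a (map (\<lambda>(r, i). (q * r, i)) l)"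
    by (induction l) (auto simp: rational_combination_def of_rat_mult scaleR_add_right)
  then show "real_of_rat q *\<^sub>R x \<in> range (rational_combination a)"
    using l by (intro range_eqI) simp
qed

text \<open>This is the construction in Whitley's proof of the Eberlein--Smulian theorem. For each rational
  combination \<open>v\<close> of the sequence fix a functional \<open>\<phi> (v - z)\<close> norming \<open>v - z\<close>. The points \<open>a n\<close> are
  chosen recursively, so close to \<open>z\<close> with respect to finitely many of these functionals
  that in the end \<open>\<phi> (v - z) (a n)\<close> tends to \<open>\<phi> (v - z) z\<close> for every \<open>v\<close>. A weak cluster point \<open>y\<close>
  of the sequence lies in the norm closure of the combinations, for otherwise a functional would
  separate it from them, and it satisfies \<open>\<phi> (v - z) y = \<phi> (v - z) z\<close>. Taking \<open>v\<close> close to \<open>y\<close>, the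
  norm of \<open>v - z\<close> equals \<open>\<phi> (v - z) (v - y)\<close> and is thus small; so \<open>y = z\<close>. By compactness a sequence
  whose only cluster point is \<open>z\<close> converges to \<open>z\<close>.\<close>

lemma sequence_of_weak_cluster_point:
  fixes X :: "'a::real_normed_vector set"
  assumes X: "compactin weak_topology X"
    and GX: "eventually (\<lambda>w. w \<in> X) G" and z: "inf (nhdsin weak_topology z) G \<noteq> bot"
    and P: "\<And>n :: nat. eventually (P n) G"
  obtains a where "\<And>n. P n (a n)" "limitin weak_topology a z sequentially"
proof -
  define N where "N = inf (nhdsin weak_topology z) G"
  have "\<exists>f :: 'a \<Rightarrow>\<^sub>L real. blinfun_apply f u = norm u \<and> (\<forall>x. \<bar>blinfun_apply f x\<bar> \<le> norm x)" for u
    using norming_functional[of u] by metis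
  then obtain \<phi> :: "'a \<Rightarrow> 'a \<Rightarrow>\<^sub>L real"
    where \<phi>: "\<And>u. blinfun_apply (\<phi> u) u = norm u" "\<And>u x. \<bar>blinfun_apply (\<phi> u) x\<bar> \<le> norm x"
    by metis
  \<comment> \<open>Stage \<open>n\<close> treats finitely many combinations, and only those of the points chosen before;
    every combination is treated at all sufficiently late stages.\<close>
  define L where "L n = {l :: (rat \<times> nat) list. to_nat l < n \<and> snd ` set l \<subseteq> {..<n}}" for n
  have finite_L: "finite (L n)" for n
  proof (rule finite_subset)
    show "L n \<subseteq> from_nat ` {..<n}"
      unfolding L_def by (force intro: image_eqI[of _ _ "to_nat _"])
  qed simp
  define Q where "Q a n w \<longleftrightarrow> w \<in> X \<and> P n w \<and>
      (\<forall>l\<in>L n. \<bar>\<phi> (rational_combination a l - z) w - \<phi> (rational_combination a l - z) z\<bar> < inverse (real (Suc n)))"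
    for a n w
  have "\<exists>w. Q a n w" for a n
  proof -
    have "eventually (\<lambda>w. \<bar>blinfun_apply f w - blinfun_apply f z\<bar> < inverse (real (Suc n))) N" for f :: "'a \<Rightarrow>\<^sub>L real"
      using tendsto_mono[OF _ tendsto_nhdsin_weak_topology[of f z], of N]
      by (auto simp: N_def tendsto_iff dist_real_def)
    then have "eventually (\<lambda>w. \<forall>l\<in>L n. \<bar>\<phi> (rational_combination a l - z) w - \<phi> (rational_combination a l - z) z\<bar> < inverse (real (Suc n))) N"
      by (intro eventually_ball_finite finite_L) auto
    moreover have "eventually (\<lambda>w. w \<in> X \<and> P n w) N"
      using eventually_conj[OF GX P[of n]] unfolding N_def by (rule filter_leD[rotated]) simp
    ultimately have "eventually (Q a n) N"
      by eventually_elim (auto simp: Q_def)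
    then show ?thesis
      using z by (auto simp: N_def dest!: eventually_happens)
  qed
  moreover have "Q a n w = Q b n w" if "\<And>i. i < n \<Longrightarrow> a i = b i" for a b n w
  proof -
    have "rational_combination a l = rational_combination b l" if "l \<in> L n" for l
      using that \<open>\<And>i. i < n \<Longrightarrow> a i = b i\<close> by (intro rational_combination_cong) (auto simp: L_def)
    then show ?thesis
      by (simp add: Q_def)
  qed
  ultimately have "\<exists>a. \<forall>n. Q a n (a n)"
    by (rule dependent_wellorder_choice[rotated])
  then obtain a where a: "\<And>n. Q a n (a n)"
    by blast
  have lim: "(\<lambda>n. \<phi> (v - z) (a n)) \<longlonglongrightarrow> \<phi> (v - z) z" if v: "v \<in> range (rational_combination a)" for v
  proof -
    obtain l where l: "v = rational_combination a l"
      using v by blast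
    obtain k where k: "snd ` set l \<subseteq> {..<k}"
      using finite_nat_iff_bounded[of "snd ` set l"] by auto
    have "l \<in> L n" if "n \<ge> max k (Suc (to_nat l))" for n
      using k that by (auto simp: L_def)
    then have "eventually (\<lambda>n. norm (\<phi> (v - z) (a n) - \<phi> (v - z) z) \<le> inverse (real (Suc n))) sequentially"
      using a unfolding Q_def l eventually_sequentially
      by (intro exI[of _ "max k (Suc (to_nat l))"]) (fastforce intro: less_imp_le)
    then have "(\<lambda>n. \<phi> (v - z) (a n) - \<phi> (v - z) z) \<longlonglongrightarrow> 0"
      by (rule Lim_null_comparison) (rule LIMSEQ_inverse_real_of_nat)
    then show ?thesis
      by (simp add: LIM_zero_iff)
  qed
  have "limitin weak_topology a z sequentially"
  proof (rule limitin_if_unique_cluster_point[OF X])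
    show "\<forall>\<^sub>F n in sequentially. a n \<in> X"
      using a by (simp add: Q_def)
  next
    fix y assume y: "inf (nhdsin weak_topology y) (filtermap a sequentially) \<noteq> bot"
    \<comment> \<open>If a functional converges along the sequence, its limit is its value at every weak cluster point.\<close>
    have eq: "blinfun_apply f y = c" if "(\<lambda>n. blinfun_apply f (a n)) \<longlonglongrightarrow> c" for f :: "'a \<Rightarrow>\<^sub>L real" and c
    proof (rule tendsto_unique[OF y])
      show "(blinfun_apply f \<longlongrightarrow> blinfun_apply f y) (inf (nhdsin weak_topology y) (filtermap a sequentially))"
        by (rule tendsto_mono[OF _ tendsto_nhdsin_weak_topology]) simp
      have "(blinfun_apply f \<longlongrightarrow> c) (filtermap a sequentially)"
        using that by (simp add: filterlim_filtermap)
      then show "(blinfun_apply f \<longlongrightarrow> c) (inf (nhdsin weak_topology y) (filtermap a sequentially))"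
        by (rule tendsto_mono[rotated]) simp
    qed
    define Y where "Y = closure (range (rational_combination a))"
    have "subspace Y"
      unfolding Y_def by (rule subspace_closure_rational_combinations)
    then obtain f :: "'a \<Rightarrow>\<^sub>L real"
      where f: "blinfun_apply f y = infdist y Y" "\<And>x. \<bar>blinfun_apply f x\<bar> \<le> infdist x Y"
      using functional_attaining_infdist[of Y y] by blast
    have "a n = rational_combination a [(1, n)]" for n
      by (simp add: rational_combination_def)
    then have "a n \<in> Y" for n
      unfolding Y_def by (intro subsetD[OF closure_subset] range_eqI)
    then have "blinfun_apply f (a n) = 0" for n
      using f(2)[of "a n"] by simp
    then have "infdist y Y = 0"
      using eq[of f 0] f(1) by simp
    then have yY: "y \<in> closure (range (rational_combination a))"
      using \<open>subspace Y\<close> subspace_0 in_closure_iff_infdist_zero[of Y y] by (auto simp: Y_def)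
    have "norm (y - z) \<le> e" if "e > 0" for e
    proof -
      obtain v where v: "v \<in> range (rational_combination a)" "dist v y < e / 2"
        using yY \<open>e > 0\<close> unfolding closure_approachable by (meson half_gt_zero)
      have "norm (v - z) = \<phi> (v - z) (v - y)"
        using eq[OF lim[OF v(1)]] \<phi>(1)[of "v - z"] by (simp add: blinfun.diff_right)
      also have "\<dots> \<le> norm (v - y)"
        using \<phi>(2)[of "v - z" "v - y"] by simp
      finally have "dist v z \<le> dist v y"
        by (simp add: dist_norm)
      then show ?thesis
        using v(2) dist_triangle[of y z v] by (simp add: dist_commute dist_norm norm_minus_commute)
    qed
    then have "norm (y - z) \<le> 0"
      by (rule field_le_epsilon[of _ 0, simplified])
    then show "y = z"
      by simp
  qed simp
  moreover have "P n (a n)" for n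
    using a by (simp add: Q_def)
  ultimately show ?thesis
    by (intro that)
qed

section \<open>Metric functionals and the Opial property\<close>

text \<open>Stated for the limit of the differences, the Opial property no longer involves lower limits:
  a nonnegative \<open>\<delta>\<close> could be taken out of the lower limit of \<open>norm (a n - z)\<close>, which would then
  be at least that of \<open>norm (a n - y)\<close>.\<close>

lemma opial_property_limit_neg:
  fixes a :: "nat \<Rightarrow> 'a::real_normed_vector"
  assumes "opial_property TYPE('a)" "limitin weak_topology a z sequentially" "y \<noteq> z"
    and lim: "(\<lambda>n. norm (a n - z) - norm (a n - y)) \<longlonglongrightarrow> \<delta>"
  shows "\<delta> < 0"
proof (rule ccontr)
  assume "\<not> \<delta> < 0"
  have "(\<lambda>n. ereal (norm (a n - z) - norm (a n - y))) \<longlonglongrightarrow> ereal \<delta>"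
    using lim by simp
  then have "liminf (\<lambda>n. ereal (norm (a n - z) - norm (a n - y)) + ereal (norm (a n - y))) =
      ereal \<delta> + liminf (\<lambda>n. ereal (norm (a n - y)))"
    by (rule ereal_liminf_lim_add) simp
  then have "liminf (\<lambda>n. ereal (norm (a n - z))) = ereal \<delta> + liminf (\<lambda>n. ereal (norm (a n - y)))"
    by simp
  also have "\<dots> \<ge> liminf (\<lambda>n. ereal (norm (a n - y)))"
    using add_right_mono[of 0 "ereal \<delta>"] \<open>\<not> \<delta> < 0\<close> by simp
  finally show False
    using assms(1-3) by (auto simp: opial_property_def not_less[symmetric])
qed

text \<open>The minimum \<open>z\<close> is chosen once, as a weak cluster point of a filter \<open>G\<close> along which the internal
  functionals converge to \<open>h\<close>. The sequence converging to \<open>z\<close> is extracted anew for each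
  competitor \<open>y\<close>.\<close>

theorem metric_functional_strict_minimum:
  fixes X :: "'a::real_normed_vector set"
  assumes opial: "opial_property TYPE('a)"
    and X: "compactin weak_topology X" and h: "h \<in> metric_functionals X p"
  obtains z where "z \<in> X" "\<And>y. y \<in> X \<Longrightarrow> y \<noteq> z \<Longrightarrow> h z < h y"
proof -
  define PT where "PT = product_topology (\<lambda>_ :: 'a. euclideanreal) X"
  define G where "G = inf (filtercomap (internal_functional X p) (nhdsin PT h)) (principal X)"
  have hcl: "h \<in> PT closure_of (internal_functional X p ` X)"
    using h by (simp add: metric_functionals_def PT_def)
  have GX: "eventually (\<lambda>w. w \<in> X) G"
    by (simp add: G_def eventually_inf_principal)
  have "G \<noteq> bot"
    unfolding G_def by (rule filtercomap_nhdsin_closure_of[OF hcl])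
  then obtain z where z: "z \<in> X" "inf (nhdsin weak_topology z) G \<noteq> bot"
    using compactin_cluster_point[OF X _ GX] by blast
  have "limitin PT (\<lambda>g. g) h (nhdsin PT h)"
    using hcl by (auto simp: limitin_def eventually_nhdsin in_closure_of)
  then have coord: "((\<lambda>g. g x) \<longlongrightarrow> h x) (nhdsin PT h)" if "x \<in> X" for x
    using that by (simp add: PT_def limitin_componentwise)
  have G_lim: "((\<lambda>w. internal_functional X p w x) \<longlongrightarrow> h x) G" if "x \<in> X" for x
  proof -
    have "((\<lambda>w. internal_functional X p w x) \<longlongrightarrow> h x) (filtercomap (internal_functional X p) (nhdsin PT h))"
      using filterlim_compose[OF coord[OF that] filterlim_filtercomap] .
    then show ?thesis
      by (rule tendsto_mono[rotated]) (simp add: G_def)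
  qed
  have "h z < h y" if y: "y \<in> X" "y \<noteq> z" for y
  proof -
    define P where "P n w \<longleftrightarrow> \<bar>internal_functional X p w z - h z\<bar> < inverse (real (Suc n)) \<and>
        \<bar>internal_functional X p w y - h y\<bar> < inverse (real (Suc n))" for n w
    have "eventually (P n) G" for n
      using G_lim[OF z(1)] G_lim[OF y(1)] unfolding P_def
      by (intro eventually_conj) (auto simp: tendsto_iff dist_real_def)
    then obtain a where a: "\<And>n. P n (a n)" "limitin weak_topology a z sequentially"
      using sequence_of_weak_cluster_point[OF X GX z(2), of P] by blast
    have lim: "(\<lambda>n. internal_functional X p (a n) x) \<longlonglongrightarrow> h x" if "x = z \<or> x = y" for x
    proof -
      have "norm (internal_functional X p (a n) x - h x) \<le> inverse (real (Suc n))" for n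
        using a(1)[of n] that by (auto simp: P_def)
      then have "(\<lambda>n. internal_functional X p (a n) x - h x) \<longlonglongrightarrow> 0"
        by (intro Lim_null_comparison[OF always_eventually LIMSEQ_inverse_real_of_nat]) simp
      then show ?thesis
        by (simp add: LIM_zero_iff)
    qed
    have "internal_functional X p w z - internal_functional X p w y = norm (w - z) - norm (w - y)" for w
      using z(1) y(1) by (simp add: internal_functional_def dist_norm norm_minus_commute)
    then have "(\<lambda>n. norm (a n - z) - norm (a n - y)) \<longlonglongrightarrow> h z - h y"
      using tendsto_diff[OF lim[of z] lim[of y]] by simp
    then have "h z - h y < 0"
      by (rule opial_property_limit_neg[OF opial a(2) y(2)])
    then show ?thesis
      by simp
  qed
  with z(1) show ?thesis
    by (rule that)
qed

theorem theorem3p5: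
  fixes X :: "'a::banach set" and p :: 'a and T :: "'a \<Rightarrow> 'a" and h :: "'a \<Rightarrow> real"
  assumes "opial_property TYPE('a)"
    and "X \<noteq> {}"
    and "compactin weak_topology X"
    and "p \<in> X"
    and "T \<in> X \<rightarrow> X"
    and "h \<in> metric_functionals X p"
    and "\<And>x. x \<in> X \<Longrightarrow> h (T x) \<le> h x"
  shows "\<exists>x\<in>X. T x = x"
proof -
  obtain z where z: "z \<in> X" "\<And>y. y \<in> X \<Longrightarrow> y \<noteq> z \<Longrightarrow> h z < h y"
    using metric_functional_strict_minimum[OF assms(1,3,6)] by blast
  have "T z \<in> X"
    using assms(5) z(1) by blast
  then have "T z = z"
    using z(2) assms(7)[OF z(1)] by (meson not_less)
  with z(1) show ?thesis
    by blast
qed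

end
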